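(* Let $n\geq 1$ be an integer and $r\in(0,1)$. Let $T^{*}$ be the $n\times n$ lower triangular Toeplitz matrix $$T^{*}=\left(\begin{array}{ccccc} r & 0 & \ldots & \ldots & 0\\ 1-r^{2} & r & \ddots & & \vdots\\ -r(1-r^{2}) & 1-r^{2} & r & \ddots & \vdots\\ \vdots & \ddots & \ddots & \ddots & 0\\ (-r)^{n-2}(1-r^{2}) & \ldots & -r(1-r^{2}) & 1-r^{2} & r \end{array}\right),$$ that is, $(T^{*})_{ij}=0$ if $i<j$, $(T^{*})_{ij}=r$ if $i=j$, and $(T^{*})_{ij}=(-r)^{i-j-1}(1-r^{2})$ if $i>j$. Let $X_{1+r}$ be the $n\times n$ matrix with entries $(X_{1+r})_{ij}=0$ if $i<j$, $(X_{1+r})_{ij}=1$ if $i=j$, and $(X_{1+r})_{ij}=1+r$ if $i>j$. Then $T^{*}\in\mathcal{C}_{n}$, and for every $\zeta\in\mathbb{C}\setminus\mathbb{D}$ and every $T\in\mathcal{C}_{n}$ with $\rho(T)\leq r$ we have $$\|R(\zeta,T)\|\leq\|(1-T^{*})^{-1}\|=\frac{1}{1-r}\|X_{1+r}\|.$$ In particular, $\mathcal{R}_{n,r}=\|(1-T^{*})^{-1}\|$.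
   Context: $\mathbb{D}=\{z\in\mathbb{C}:|z|<1\}$ is the open unit disc. For a complex $n\times n$ matrix $T$, $\|T\|$ is the operator norm associated with the standard Hilbert (Euclidean) norm on $\mathbb{C}^{n}$, $\sigma(T)$ is the spectrum, and $\rho(T)=\max_{\lambda\in\sigma(T)}|\lambda|$ is the spectral radius. $\mathcal{C}_{n}$ is the set of complex $n\times n$ matrices $T$ with $\|T\|\leq1$ (contractions). For $\zeta\notin\sigma(T)$, $R(\zeta,T)=(\zeta-T)^{-1}$, where a scalar $\zeta$ stands for $\zeta$ times the identity matrix. For $r\in(0,1)$, $$\mathcal{R}_{n,r}:=\sup\{\|R(\zeta,T)\| : T\in\mathcal{C}_{n},\ \rho(T)\leq r\},$$ where $\zeta$ is any complex number with $|\zeta|=1$ (the value does not depend on the choice of such $\zeta$). The symbol $T^{*}$ is just the name of the specific matrix displayed in the claim; it does not denote the adjoint of $T$. *)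

theory Defs
  imports
    "HOL-Analysis.L2_Norm"
    "Jordan_Normal_Form.Spectral_Radius"
    "Jordan_Normal_Form.Gauss_Jordan_Elimination"
begin

definition euclidean_norm :: "complex vec \<Rightarrow> real" where
  "euclidean_norm v = L2_set (\<lambda>i. cmod (v $ i)) {..<dim_vec v}"

definition operator_norm :: "complex mat \<Rightarrow> real" where
  "operator_norm A =
    Sup {euclidean_norm (A *\<^sub>v v) | v. v \<in> carrier_vec (dim_col A) \<and> euclidean_norm v \<le> 1}"

(* Unspecified for a matrix that is not square or not invertible. *)
definition inverse_matrix :: "complex mat \<Rightarrow> complex mat" where
  "inverse_matrix A = the (mat_inverse A)"

definition resolvent :: "complex \<Rightarrow> complex mat \<Rightarrow> complex mat" where
  "resolvent \<zeta> T = inverse_matrix (\<zeta> \<cdot>\<^sub>m 1\<^sub>m (dim_row T) - T)"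

definition contractions :: "nat \<Rightarrow> complex mat set" where
  "contractions n = {T \<in> carrier_mat n n. operator_norm T \<le> 1}"

(* The point \<zeta> of the unit circle is kept as a parameter; independence of the
   choice of \<zeta> is not built into the definition. *)
definition resolvent_sup :: "nat \<Rightarrow> real \<Rightarrow> complex \<Rightarrow> real" where
  "resolvent_sup n r \<zeta> =
    Sup {operator_norm (resolvent \<zeta> T) | T. T \<in> contractions n \<and> spectral_radius T \<le> r}"

(* Matrix indices start at 0, which does not affect the Toeplitz entries below. *)
definition T_star :: "nat \<Rightarrow> real \<Rightarrow> complex mat" where
  "T_star n r = mat n n (\<lambda>(i, j).
     if i < j then 0
     else if i = j then complex_of_real r
     else complex_of_real ((- r) ^ (i - j - 1) * (1 - r\<^sup>2)))"

definition X_matrix :: "nat \<Rightarrow> real \<Rightarrow> complex mat" where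
  "X_matrix n \<beta> = mat n n (\<lambda>(i, j).
     if i < j then 0 else if i = j then 1 else complex_of_real \<beta>)"

end

(*
  For a contraction T and |zeta| >= 1 the matrix D = zeta (zeta - T)^-1 satisfies
  2 Re <D x, x> >= |x|^2, and |d| <= 1 / (1 - r) for each of its eigenvalues d. In a unitary
  Schur basis D is upper triangular, its diagonal entries are eigenvalues, and the 2 x 2
  principal blocks of D + D^* - 1 >= 0 bound the entries above the diagonal by
  2 / (1 - r) - 1 = (1 + r) / (1 - r). Hence D is dominated entrywise by X_{1+r} / (1 - r),
  up to reversing the order of the basis. Equality holds for T^*: (1 - T^* )^-1 = X_{1+r} / (1 - r),
  and T^* is a contraction because X + X^* is (1 - r) I plus (1 + r) times the all-ones matrix.
*)
theory Submission
  imports Defs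
begin

section \<open>Unitary triangularization\<close>

text \<open>The extremal matrix comes from asking for equality in all entry bounds at once. With
  \<open>S\<close> the lower shift, X_{1+r} = (1 + r S) (1 - S)^{-1}; solving (1 - T)^{-1} = X_{1+r}
  / (1 - r) gives T = (r + S) (1 + r S)^{-1}, a disc automorphism applied to \<open>S\<close>, and
  its expansion in powers of \<open>S\<close> has the displayed Toeplitz coefficients. The
  triangularizing basis has to be unitary: a general similarity keeps eigenvalues but neither norms
  nor the inequality 2 Re <D x, x> >= |x|^2. The factor zeta in D removes zeta from both constraints
  on D and can only increase the norm, so one estimate covers all |zeta| >= 1. Contractivity and
  coercivity are two forms of one condition: |y - x| <= |y| iff |x|^2 <= 2 Re <y, x>. The upper
  bound reads it from left to right, the contractivity of the extremal matrix from right to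
  left.\<close>

lemma index_mat_adjoint:
  assumes "A \<in> carrier_mat m n" "i < n" "j < m"
  shows "mat_adjoint A $$ (i, j) = conjugate (A $$ (j, i))"
  using assms unfolding mat_adjoint_def by (simp add: mat_of_rows_index)

lemma dim_mat_adjoint [simp]:
  "dim_row (mat_adjoint A) = dim_col A" "dim_col (mat_adjoint A) = dim_row A"
  unfolding mat_adjoint_def by (auto simp: mat_of_rows_def)

lemma mat_adjoint_carrier: "A \<in> carrier_mat m n \<Longrightarrow> mat_adjoint A \<in> carrier_mat n m"
  by auto

lemma mat_adjoint_mult:
  fixes A B :: "'a :: conjugatable_field mat"
  assumes A: "A \<in> carrier_mat m k" and B: "B \<in> carrier_mat k n"
  shows "mat_adjoint (A * B) = mat_adjoint B * mat_adjoint A"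
proof (rule eq_matI)
  note car = mat_adjoint_carrier[OF A] mat_adjoint_carrier[OF B]
  fix i j assume "i < dim_row (mat_adjoint B * mat_adjoint A)" "j < dim_col (mat_adjoint B * mat_adjoint A)"
  then have ij: "i < n" "j < m" using car by auto
  have "mat_adjoint (A * B) $$ (i, j) = conjugate ((A * B) $$ (j, i))"
    using index_mat_adjoint[OF mult_carrier_mat[OF A B] ij] .
  also have "\<dots> = (\<Sum>l<k. mat_adjoint B $$ (i, l) * mat_adjoint A $$ (l, j))"
    using A B ij
    by (auto simp: scalar_prod_def sum_conjugate conjugate_dist_mul index_mat_adjoint[OF A]
        index_mat_adjoint[OF B] mult.commute lessThan_atLeast0 intro!: sum.cong)
  also have "\<dots> = (mat_adjoint B * mat_adjoint A) $$ (i, j)"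
    using A B ij by (auto simp: scalar_prod_def lessThan_atLeast0 intro!: sum.cong)
  finally show "mat_adjoint (A * B) $$ (i, j) = (mat_adjoint B * mat_adjoint A) $$ (i, j)" .
qed (use mat_adjoint_carrier[OF mult_carrier_mat[OF A B]] mat_adjoint_carrier[OF A]
    mat_adjoint_carrier[OF B] in auto)

lemma mult_mat_vec_adjoint:
  fixes A :: "complex mat"
  assumes A: "A \<in> carrier_mat m n" and x: "x \<in> carrier_vec n" and y: "y \<in> carrier_vec m"
  shows "(A *\<^sub>v x) \<bullet>c y = x \<bullet>c (mat_adjoint A *\<^sub>v y)"
proof -
  have "(A *\<^sub>v x) \<bullet>c y = (\<Sum>i<m. \<Sum>j<n. A $$ (i, j) * x $ j * cnj (y $ i))"
    using assms by (auto simp: scalar_prod_def lessThan_atLeast0 sum_distrib_right intro!: sum.cong)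
  also have "\<dots> = (\<Sum>j<n. \<Sum>i<m. A $$ (i, j) * x $ j * cnj (y $ i))"
    by (rule sum.swap)
  also have "\<dots> = x \<bullet>c (mat_adjoint A *\<^sub>v y)"
    using assms
    by (auto simp: scalar_prod_def lessThan_atLeast0 sum_distrib_left index_mat_adjoint[OF A] ac_simps
        intro!: sum.cong)
  finally show ?thesis .
qed

lemma euclidean_norm_power2: "complex_of_real ((euclidean_norm v)\<^sup>2) = v \<bullet>c v"
proof -
  have "(euclidean_norm v)\<^sup>2 = (\<Sum>i<dim_vec v. (cmod (v $ i))\<^sup>2)"
    unfolding euclidean_norm_def L2_set_def by (simp add: sum_nonneg)
  then show ?thesis
    by (simp add: scalar_prod_def complex_norm_square lessThan_atLeast0 del: of_real_power)
qed

lemma euclidean_norm_nonneg [simp]: "0 \<le> euclidean_norm v"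
  unfolding euclidean_norm_def by simp

lemma euclidean_norm_smult: "euclidean_norm (c \<cdot>\<^sub>v v) = cmod c * euclidean_norm v"
  unfolding euclidean_norm_def by (auto simp: norm_mult L2_set_right_distrib intro!: L2_set_cong)

lemma euclidean_norm_eq_0_iff: "v \<in> carrier_vec n \<Longrightarrow> euclidean_norm v = 0 \<longleftrightarrow> v = 0\<^sub>v n"
  unfolding euclidean_norm_def by (auto simp: L2_set_eq_0_iff)

text \<open>Complete \<open>v\<close> to a basis and orthogonalize: Gram-Schmidt leaves the first
  vector unchanged, so after normalization the first column is still a multiple of \<open>v\<close>.
  The scalar \<open>c\<close> is harmless because only the direction of an eigenvector
  matters.\<close>

lemma exists_unitary_with_first_column:
  fixes v :: "complex vec"
  assumes v: "v \<in> carrier_vec n" and v0: "v \<noteq> 0\<^sub>v n"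
  shows "\<exists>W c. W \<in> carrier_mat n n \<and> mat_adjoint W * W = 1\<^sub>m n \<and> col W 0 = c \<cdot>\<^sub>v v"
proof -
  interpret cof_vec_space n "TYPE(complex)" .
  define b where "b = basis_completion v"
  define ws where "ws = gram_schmidt n b"
  from basis_completion[OF v v0, folded b_def]
  have dist_b: "distinct b" and indep: "\<not> lin_dep (set b)" and b: "set b \<subseteq> carrier_vec n"
    and hdb: "hd b = v" and len_b: "length b = n" by auto
  from gram_schmidt_result[OF b dist_b indep refl, folded ws_def]
  have ws: "set ws \<subseteq> carrier_vec n" "corthogonal ws" "length ws = n"
    by (auto simp: len_b)
  have n: "n \<noteq> 0" using v v0 by (intro notI) auto
  with hdb len_b obtain vs where bv: "b = v # vs" by (cases b) auto
  from gram_schmidt_hd[OF v, of vs, folded bv] have hdws: "hd ws = v" unfolding ws_def .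
  \<comment> \<open>The Gram-Schmidt vectors are orthogonal but not of length one; dividing by the
    lengths makes \<open>W\<close> unitary.\<close>
  define us where "us = map (\<lambda>w. complex_of_real (1 / euclidean_norm w) \<cdot>\<^sub>v w) ws"
  define W where "W = mat_of_cols n us"
  have wsc: "ws ! i \<in> carrier_vec n" if "i < n" for i
    using ws that by (metis nth_mem subsetD)
  have usc: "us ! i = complex_of_real (1 / euclidean_norm (ws ! i)) \<cdot>\<^sub>v ws ! i" if "i < n" for i
    using that ws by (simp add: us_def)
  have W: "W \<in> carrier_mat n n"
    using ws mat_of_cols_carrier(1)[of n us] by (simp add: W_def us_def)
  have colW: "col W i = us ! i" if "i < n" for i
    using that ws wsc usc unfolding W_def by (intro col_mat_of_cols) (auto simp: us_def)
  have orth: "us ! j \<bullet>c us ! i = (if i = j then 1 else 0)" if ij: "i < n" "j < n" for i j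
  proof -
    have prod: "us ! j \<bullet>c us ! i = complex_of_real (1 / euclidean_norm (ws ! j))
        * complex_of_real (1 / euclidean_norm (ws ! i)) * (ws ! j \<bullet>c ws ! i)"
      using ij wsc[of i] wsc[of j] by (simp add: usc conjugate_smult_vec)
    \<comment> \<open>The equivalence also covers \<open>i = j\<close>: the vectors are nonzero, so
      the division by their lengths is sound.\<close>
    have z: "(ws ! j \<bullet>c ws ! i = 0) = (j \<noteq> i)"
      using corthogonalD[OF ws(2)] ij ws(3) by simp
    show ?thesis
    proof (cases "i = j")
      case True
      with z have "ws ! i \<bullet>c ws ! i \<noteq> 0" by simp
      then have "euclidean_norm (ws ! i) \<noteq> 0"
        unfolding euclidean_norm_power2[symmetric] by simp
      then show ?thesis
        using True unfolding prod euclidean_norm_power2[symmetric]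
        by (simp add: euclidean_norm_power2[symmetric] power2_eq_square)
    next
      case False
      then show ?thesis unfolding prod using z by simp
    qed
  qed
  have "mat_adjoint W * W = 1\<^sub>m n"
  proof (rule eq_matI)
    fix i j assume "i < dim_row (1\<^sub>m n)" "j < dim_col (1\<^sub>m n)"
    then have ij: "i < n" "j < n" by auto
    have uc: "us ! i \<in> carrier_vec n" "us ! j \<in> carrier_vec n"
      using ij wsc usc by auto
    have "row (mat_adjoint W) i = conjugate (us ! i)"
      using ij W colW uc by (intro eq_vecI) (auto simp: index_mat_adjoint[OF W] simp flip: colW)
    then have "(mat_adjoint W * W) $$ (i, j) = conjugate (us ! i) \<bullet> us ! j"
      using ij W colW by simp
    also have "\<dots> = us ! j \<bullet>c us ! i"
      using uc by (intro comm_scalar_prod) auto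
    also have "\<dots> = 1\<^sub>m n $$ (i, j)" using orth[OF ij] ij by simp
    finally show "(mat_adjoint W * W) $$ (i, j) = 1\<^sub>m n $$ (i, j)" .
  qed (use W mat_adjoint_carrier[OF W] in auto)
  moreover have "col W 0 = complex_of_real (1 / euclidean_norm v) \<cdot>\<^sub>v v"
    using colW[of 0] usc[of 0] n hdws ws hd_conv_nth[of ws] by auto
  ultimately show ?thesis using W by blast
qed

text \<open>Deflation by induction on the size: a unitary whose first column is an eigenvector
  clears the first column below the diagonal, and the remaining block is triangularized recursively.
  One-sided unitarity is stated because for square matrices the other side follows.\<close>

theorem unitary_schur_triangularization:
  fixes A :: "complex mat"
  assumes "A \<in> carrier_mat n n"
  shows "\<exists>U B. U \<in> carrier_mat n n \<and> B \<in> carrier_mat n n \<and> mat_adjoint U * U = 1\<^sub>m n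
    \<and> upper_triangular B \<and> A * U = U * B"
  using assms
proof (induction n arbitrary: A)
  case 0
  then show ?case
    by (intro exI[of _ "1\<^sub>m 0"] exI[of _ A]) (auto simp: mat_adjoint_def upper_triangular_def)
next
  case (Suc n)
  note A = Suc.prems
  from spectrum_non_empty[OF A] obtain e where "eigenvalue A e"
    by (auto simp: spectrum_def)
  then obtain v where v: "v \<in> carrier_vec (Suc n)" "v \<noteq> 0\<^sub>v (Suc n)" and Av: "A *\<^sub>v v = e \<cdot>\<^sub>v v"
    using A unfolding eigenvalue_def eigenvector_def by auto
  from exists_unitary_with_first_column[OF v] obtain W c
    where W: "W \<in> carrier_mat (Suc n) (Suc n)" and WW: "mat_adjoint W * W = 1\<^sub>m (Suc n)"
      and W0: "col W 0 = c \<cdot>\<^sub>v v" by blast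
  note W' = mat_adjoint_carrier[OF W]
  have WW': "W * mat_adjoint W = 1\<^sub>m (Suc n)"
    using mat_mult_left_right_inverse[OF W' W WW] .
  define A' where "A' = mat_adjoint W * (A * W)"
  have A': "A' \<in> carrier_mat (Suc n) (Suc n)" unfolding A'_def by (intro mult_carrier_mat[OF W'] mult_carrier_mat[OF A W])
  have WA': "W * A' = A * W"
  proof -
    have "W * A' = W * mat_adjoint W * (A * W)"
      unfolding A'_def by (rule assoc_mult_mat[OF W W' mult_carrier_mat[OF A W], symmetric])
    then show ?thesis unfolding WW' by (simp only: left_mult_one_mat[OF mult_carrier_mat[OF A W]])
  qed
  \<comment> \<open>The first column of \<open>W\<close> is an eigenvector for \<open>e\<close>, and
    \<open>mat_adjoint W\<close> sends it to the first unit vector.\<close>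
  have "col A' 0 = mat_adjoint W *\<^sub>v (A *\<^sub>v col W 0)"
    unfolding A'_def col_mult2[OF W' mult_carrier_mat[OF A W] zero_less_Suc]
      col_mult2[OF A W zero_less_Suc] ..
  also have "A *\<^sub>v col W 0 = e \<cdot>\<^sub>v col W 0"
    unfolding W0 mult_mat_vec[OF A v(1)] Av by (simp add: smult_smult_assoc mult.commute)
  also have "mat_adjoint W *\<^sub>v (e \<cdot>\<^sub>v col W 0) = e \<cdot>\<^sub>v col (mat_adjoint W * W) 0"
    unfolding col_mult2[OF W' W zero_less_Suc]
    using mult_mat_vec[OF W' carrier_vecI[of "col W 0"]] W by simp
  also have "\<dots> = e \<cdot>\<^sub>v unit_vec (Suc n) 0" unfolding WW by simp
  finally have colA': "col A' 0 = e \<cdot>\<^sub>v unit_vec (Suc n) 0" .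
  have A'0: "A' $$ (Suc i, 0) = 0" if "i < n" for i
    using arg_cong[OF colA', of "\<lambda>v. v $ Suc i"] that A' by auto
  obtain A1 A2 A0 A3 where split: "split_block A' 1 1 = (A1, A2, A0, A3)"
    by (cases "split_block A' 1 1") auto
  have dim: "dim_row A' = 1 + n" "dim_col A' = 1 + n" using A' by auto
  from split_block[OF split dim] have A1: "A1 \<in> carrier_mat 1 1" and A2: "A2 \<in> carrier_mat 1 n"
    and A0: "A0 \<in> carrier_mat n 1" and A3: "A3 \<in> carrier_mat n n"
    and block: "A' = four_block_mat A1 A2 A0 A3" by auto
  have A0_eq: "A0 = 0\<^sub>m n 1"
    using split[unfolded split_block_def Let_def] A'0 A' by auto
  from Suc.IH[OF A3] obtain U3 B3 where U3: "U3 \<in> carrier_mat n n" and B3: "B3 \<in> carrier_mat n n"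
    and UU3: "mat_adjoint U3 * U3 = 1\<^sub>m n" and ut3: "upper_triangular B3"
    and AU3: "A3 * U3 = U3 * B3" by blast
  \<comment> \<open>Bordering \<open>U3\<close> by 1 acts only on the last \<open>n\<close>
    coordinates, so the cleared first column stays as it is.\<close>
  define U' where "U' = four_block_mat (1\<^sub>m 1) (0\<^sub>m 1 n) (0\<^sub>m n 1) U3"
  define B where "B = four_block_mat A1 (A2 * U3) (0\<^sub>m n 1) B3"
  have U': "U' \<in> carrier_mat (Suc n) (Suc n)" and B: "B \<in> carrier_mat (Suc n) (Suc n)"
    using four_block_carrier_mat[OF one_carrier_mat U3, of 1] four_block_carrier_mat[OF A1 B3]
    by (simp_all add: U'_def B_def)
  have "A' * U' = four_block_mat A1 (A2 * U3) (0\<^sub>m n 1) (A3 * U3)"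
    unfolding block U'_def A0_eq
    by (subst mult_four_block_mat[of _ 1 1 _ n _ n _ _ 1 _ n]) (use A1 A2 A3 U3 in auto)
  moreover have "U' * B = four_block_mat A1 (A2 * U3) (0\<^sub>m n 1) (U3 * B3)"
    unfolding U'_def B_def
    by (subst mult_four_block_mat[of _ 1 1 _ n _ n _ _ 1 _ n]) (use A1 A2 B3 U3 in auto)
  ultimately have AU': "A' * U' = U' * B" by (simp add: AU3)
  have adjU': "mat_adjoint U' = four_block_mat (1\<^sub>m 1) (0\<^sub>m 1 n) (0\<^sub>m n 1) (mat_adjoint U3)"
  proof (rule eq_matI)
    fix i j
    assume "i < dim_row (four_block_mat (1\<^sub>m 1) (0\<^sub>m 1 n) (0\<^sub>m n 1) (mat_adjoint U3))"
      "j < dim_col (four_block_mat (1\<^sub>m 1) (0\<^sub>m 1 n) (0\<^sub>m n 1) (mat_adjoint U3))"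
    then have ij: "i < Suc n" "j < Suc n" using mat_adjoint_carrier[OF U3] by auto
    show "mat_adjoint U' $$ (i, j)
        = four_block_mat (1\<^sub>m 1) (0\<^sub>m 1 n) (0\<^sub>m n 1) (mat_adjoint U3) $$ (i, j)"
      unfolding index_mat_adjoint[OF U' ij] unfolding U'_def using ij carrier_matD[OF U3]
      by (cases i; cases j) (simp_all add: index_mat_adjoint[OF U3])
  qed (use U' U3 in auto)
  have UU': "mat_adjoint U' * U' = 1\<^sub>m (Suc n)"
    unfolding adjU' unfolding U'_def
    by (subst mult_four_block_mat[of _ 1 1 _ n _ n _ _ 1 _ n])
      (use U3 mat_adjoint_carrier[OF U3] UU3 four_block_one_mat[of 1 n] in auto)
  have ut: "upper_triangular B"
    unfolding B_def
    by (rule upper_triangular_four_block[OF A1 B3 _ ut3]) (use A1 in \<open>auto simp: upper_triangular_def\<close>)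
  have "A * (W * U') = W * U' * B"
    unfolding assoc_mult_mat[OF W U' B] AU'[symmetric] assoc_mult_mat[OF W A' U', symmetric] WA'
    by (rule assoc_mult_mat[OF A W U', symmetric])
  moreover have "mat_adjoint (W * U') * (W * U') = 1\<^sub>m (Suc n)"
  proof -
    have "mat_adjoint (W * U') * (W * U') = mat_adjoint U' * (mat_adjoint W * W * U')"
      unfolding mat_adjoint_mult[OF W U'] assoc_mult_mat[OF W' W U']
      by (rule assoc_mult_mat[OF mat_adjoint_carrier[OF U'] W' mult_carrier_mat[OF W U']])
    then show ?thesis using U' UU' by (simp add: WW)
  qed
  ultimately show ?case using W U' B ut
    by (intro exI[of _ "W * U'"] exI[of _ B]) auto
qed

section \<open>Operator norm and inverse matrices\<close>

text \<open>A real \<open>Sup\<close> carries information only for bounded sets. The sum of the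
  moduli of all entries is a crude bound, since coordinates of vectors in the unit ball have modulus
  at most 1.\<close>

lemma bdd_above_operator_norm:
  assumes A: "A \<in> carrier_mat m n"
  shows "bdd_above {euclidean_norm (A *\<^sub>v v) | v. v \<in> carrier_vec (dim_col A) \<and> euclidean_norm v \<le> 1}"
proof (rule bdd_aboveI)
  fix x assume "x \<in> {euclidean_norm (A *\<^sub>v v) | v. v \<in> carrier_vec (dim_col A) \<and> euclidean_norm v \<le> 1}"
  then obtain v where x: "x = euclidean_norm (A *\<^sub>v v)" and v: "v \<in> carrier_vec n"
    and v1: "euclidean_norm v \<le> 1" using A by auto
  have vj: "cmod (v $ j) \<le> 1" if "j < n" for j
    using member_le_L2_set[of "{..<dim_vec v}" j "\<lambda>i. cmod (v $ i)"] that v v1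
    unfolding euclidean_norm_def by auto
  have "x \<le> (\<Sum>i<m. cmod ((A *\<^sub>v v) $ i))"
    unfolding x euclidean_norm_def using A L2_set_le_sum[of "{..<m}" "\<lambda>i. cmod ((A *\<^sub>v v) $ i)"]
    by simp
  also have "\<dots> \<le> (\<Sum>i<m. \<Sum>j<n. cmod (A $$ (i, j)))"
  proof (rule sum_mono)
    fix i assume "i \<in> {..<m}"
    then have "(A *\<^sub>v v) $ i = (\<Sum>j<n. A $$ (i, j) * v $ j)"
      using A v by (simp add: scalar_prod_def lessThan_atLeast0)
    also have "cmod \<dots> \<le> (\<Sum>j<n. cmod (A $$ (i, j)))"
      using vj by (intro sum_norm_le) (auto simp: norm_mult mult_left_le)
    finally show "cmod ((A *\<^sub>v v) $ i) \<le> (\<Sum>j<n. cmod (A $$ (i, j)))" .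
  qed
  finally show "x \<le> (\<Sum>i<m. \<Sum>j<n. cmod (A $$ (i, j)))" .
qed

lemma euclidean_norm_mult_mat_vec_le:
  assumes A: "A \<in> carrier_mat m n" and v: "v \<in> carrier_vec n"
  shows "euclidean_norm (A *\<^sub>v v) \<le> operator_norm A * euclidean_norm v"
proof (cases "v = 0\<^sub>v n")
  case True
  have "A *\<^sub>v 0\<^sub>v n = 0\<^sub>v m" using A by auto
  then show ?thesis
    using euclidean_norm_eq_0_iff[of "0\<^sub>v n" n] euclidean_norm_eq_0_iff[of "0\<^sub>v m" m] True by simp
next
  case False
  then have pos: "euclidean_norm v > 0"
    using euclidean_norm_eq_0_iff[OF v] euclidean_norm_nonneg[of v] by linarith
  define w where "w = complex_of_real (1 / euclidean_norm v) \<cdot>\<^sub>v v"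
  have w: "w \<in> carrier_vec n" using v by (simp add: w_def)
  have w1: "euclidean_norm w \<le> 1"
    unfolding w_def euclidean_norm_smult using pos by (simp add: norm_divide)
  have "euclidean_norm (A *\<^sub>v w) \<le> operator_norm A"
    unfolding operator_norm_def by (rule cSup_upper[OF _ bdd_above_operator_norm[OF A]])
      (use A w w1 in auto)
  also have "A *\<^sub>v w = complex_of_real (1 / euclidean_norm v) \<cdot>\<^sub>v (A *\<^sub>v v)"
    unfolding w_def by (rule mult_mat_vec[OF A v])
  finally show ?thesis
    unfolding euclidean_norm_smult using pos by (simp add: norm_divide field_simps)
qed

lemma operator_norm_le:
  assumes A: "A \<in> carrier_mat m n" and K: "0 \<le> K"
    and le: "\<And>v. v \<in> carrier_vec n \<Longrightarrow> euclidean_norm (A *\<^sub>v v) \<le> K * euclidean_norm v"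
  shows "operator_norm A \<le> K"
  unfolding operator_norm_def
proof (rule cSup_least)
  have "euclidean_norm (0\<^sub>v n) \<le> 1"
    using euclidean_norm_eq_0_iff[of "0\<^sub>v n" n] by simp
  then have "euclidean_norm (A *\<^sub>v 0\<^sub>v n)
      \<in> {euclidean_norm (A *\<^sub>v v) | v. v \<in> carrier_vec (dim_col A) \<and> euclidean_norm v \<le> 1}"
    using A by auto
  then show "{euclidean_norm (A *\<^sub>v v) | v. v \<in> carrier_vec (dim_col A) \<and> euclidean_norm v \<le> 1} \<noteq> {}"
    by blast
next
  fix x assume "x \<in> {euclidean_norm (A *\<^sub>v v) | v. v \<in> carrier_vec (dim_col A) \<and> euclidean_norm v \<le> 1}"
  then obtain v where "x = euclidean_norm (A *\<^sub>v v)" "v \<in> carrier_vec n" "euclidean_norm v \<le> 1"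
    using A by auto
  then show "x \<le> K" using le[of v] mult_left_le[of "euclidean_norm v" K] K by linarith
qed

lemma operator_norm_nonneg:
  assumes A: "A \<in> carrier_mat m n"
  shows "0 \<le> operator_norm A"
proof -
  have "euclidean_norm (A *\<^sub>v 0\<^sub>v n) \<le> operator_norm A"
    unfolding operator_norm_def
    by (rule cSup_upper[OF _ bdd_above_operator_norm[OF A]])
      (use A euclidean_norm_eq_0_iff[of "0\<^sub>v n" n] in auto)
  then show ?thesis using euclidean_norm_nonneg[of "A *\<^sub>v 0\<^sub>v n"] by linarith
qed

lemma smult_mat_mult_mat_vec:
  fixes A :: "'a :: comm_ring_1 mat"
  assumes "A \<in> carrier_mat m n" "v \<in> carrier_vec n"
  shows "(c \<cdot>\<^sub>m A) *\<^sub>v v = c \<cdot>\<^sub>v (A *\<^sub>v v)"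
  using assms by (intro eq_vecI) (auto simp: scalar_prod_def sum_distrib_left mult.assoc)

lemma operator_norm_smult:
  assumes A: "A \<in> carrier_mat m n"
  shows "operator_norm (c \<cdot>\<^sub>m A) = cmod c * operator_norm A"
proof (rule antisym)
  have le: "operator_norm (c \<cdot>\<^sub>m A) \<le> cmod c * operator_norm A"
    if A: "A \<in> carrier_mat m n" for c and A :: "complex mat"
  proof (rule operator_norm_le)
    fix v :: "complex vec" assume v: "v \<in> carrier_vec n"
    show "euclidean_norm ((c \<cdot>\<^sub>m A) *\<^sub>v v) \<le> cmod c * operator_norm A * euclidean_norm v"
      unfolding smult_mat_mult_mat_vec[OF A v] euclidean_norm_smult
      using euclidean_norm_mult_mat_vec_le[OF A v] by (simp add: mult.assoc mult_left_mono)
  qed (use A operator_norm_nonneg[OF A] in auto)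
  then show "operator_norm (c \<cdot>\<^sub>m A) \<le> cmod c * operator_norm A" using A .
  show "cmod c * operator_norm A \<le> operator_norm (c \<cdot>\<^sub>m A)"
  proof (cases "c = 0")
    case True
    then show ?thesis using operator_norm_nonneg[of "c \<cdot>\<^sub>m A" m n] A by simp
  next
    case False
    \<comment> \<open>The reverse inequality is the first one applied to the scalar
      \<open>1 / c\<close> and the matrix \<open>c \<cdot>\<^sub>m A\<close>.\<close>
    have "(1 / c) \<cdot>\<^sub>m (c \<cdot>\<^sub>m A) = A"
      using False by (intro eq_matI) auto
    then have "operator_norm A \<le> cmod (1 / c) * operator_norm (c \<cdot>\<^sub>m A)"
      using le[of "c \<cdot>\<^sub>m A" "1 / c"] A by simp
    then show ?thesis using False by (simp add: norm_divide field_simps)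
  qed
qed

text \<open>A one-sided inverse of a square matrix is two-sided, which rules out \<open>None\<close>
  and makes the result unique. This gives meaning to the \<open>the\<close> in
  \<open>inverse_matrix\<close>.\<close>

lemma mat_inverse_eqI:
  fixes A :: "'a :: field mat"
  assumes A: "A \<in> carrier_mat n n" and B: "B \<in> carrier_mat n n" and AB: "A * B = 1\<^sub>m n"
  shows "mat_inverse A = Some B"
proof (cases "mat_inverse A")
  case None
  have "A \<in> Units (ring_mat TYPE('a) n ())"
    using A B AB mat_mult_left_right_inverse[OF A B AB] by (auto simp: Units_def ring_mat_def)
  then show ?thesis using mat_inverse(1)[OF A None, of "()"] by blast
next
  case (Some C)
  from mat_inverse(2)[OF A Some] have C: "C * A = 1\<^sub>m n" "C \<in> carrier_mat n n" by auto
  have "B = C * A * B" using B C by simp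
  also have "\<dots> = C" using assoc_mult_mat[OF C(2) A B] AB C by simp
  finally show ?thesis using Some by simp
qed

lemma inverse_matrix_eqI:
  assumes "A \<in> carrier_mat n n" "B \<in> carrier_mat n n" "A * B = 1\<^sub>m n"
  shows "inverse_matrix A = B"
  using mat_inverse_eqI[OF assms] by (simp add: inverse_matrix_def)

lemma resolvent_inverts:
  assumes T: "T \<in> carrier_mat n n" and "\<not> eigenvalue T \<zeta>"
  shows "resolvent \<zeta> T \<in> carrier_mat n n"
    and "(\<zeta> \<cdot>\<^sub>m 1\<^sub>m n - T) * resolvent \<zeta> T = 1\<^sub>m n"
proof -
  define M where "M = \<zeta> \<cdot>\<^sub>m 1\<^sub>m n - T"
  have M: "M \<in> carrier_mat n n" using T by (auto simp: M_def)
  \<comment> \<open>\<open>char_matrix\<close> has the opposite sign, \<open>T - \<zeta>\<close>;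
    the factor does not affect whether the determinant vanishes.\<close>
  have "M = (- 1) \<cdot>\<^sub>m char_matrix T \<zeta>"
    using T by (intro eq_matI) (auto simp: M_def char_matrix_def)
  then have "det M \<noteq> 0"
    using assms eigenvalue_det[OF T] by simp
  then obtain C where C: "C \<in> carrier_mat n n" "M * C = 1\<^sub>m n"
    using det_non_zero_imp_unit[OF M]
    by (auto simp: Units_def ring_mat_def)
  have "resolvent \<zeta> T = C"
    unfolding resolvent_def using inverse_matrix_eqI[OF M C] T by (simp add: M_def)
  then show "resolvent \<zeta> T \<in> carrier_mat n n"
    "(\<zeta> \<cdot>\<^sub>m 1\<^sub>m n - T) * resolvent \<zeta> T = 1\<^sub>m n"
    using C by (auto simp: M_def)
qed

section \<open>Coercive matrices\<close>

lemma unitary_euclidean_norm: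
  assumes U: "U \<in> carrier_mat n n" and UU: "mat_adjoint U * U = 1\<^sub>m n" and v: "v \<in> carrier_vec n"
  shows "euclidean_norm (U *\<^sub>v v) = euclidean_norm v"
proof -
  have Uv: "U *\<^sub>v v \<in> carrier_vec n" using U v by simp
  have "mat_adjoint U *\<^sub>v (U *\<^sub>v v) = v"
    using assoc_mult_mat_vec[OF mat_adjoint_carrier[OF U] U v] UU v by simp
  then have "complex_of_real ((euclidean_norm (U *\<^sub>v v))\<^sup>2) = complex_of_real ((euclidean_norm v)\<^sup>2)"
    unfolding euclidean_norm_power2 using mult_mat_vec_adjoint[OF U v Uv] by simp
  then show ?thesis by (simp only: of_real_eq_iff power2_eq_iff_nonneg euclidean_norm_nonneg)
qed

lemma index_mult_mat_vec_sum:
  "A \<in> carrier_mat m n \<Longrightarrow> v \<in> carrier_vec n \<Longrightarrow> i < m \<Longrightarrow>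
    (A *\<^sub>v v) $ i = (\<Sum>j<n. A $$ (i, j) * v $ j)"
  by (simp add: scalar_prod_def lessThan_atLeast0)

text \<open>The test vector \<open>e\<^sub>i + z e\<^sub>j\<close>, with \<open>z\<close> of modulus one chosen so that
  \<open>b\<^sub>i\<^sub>j z\<close> is negative, isolates the off-diagonal entry.\<close>

lemma upper_triangular_coercive_entry_bound:
  fixes B :: "complex mat"
  assumes B: "B \<in> carrier_mat n n" and ut: "upper_triangular B"
    and coercive: "\<And>x. x \<in> carrier_vec n \<Longrightarrow> (euclidean_norm x)\<^sup>2 \<le> 2 * Re ((B *\<^sub>v x) \<bullet>c x)"
    and ij: "i < j" "j < n"
  shows "cmod (B $$ (i, j)) \<le> Re (B $$ (i, i)) + Re (B $$ (j, j)) - 1"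
proof -
  define b where "b = B $$ (i, j)"
  obtain z where z: "cmod z = 1" "b * z = - complex_of_real (cmod b)"
  proof (cases "b = 0")
    case True
    then show ?thesis using that[of 1] by simp
  next
    case False
    then have "b * (- cnj b / complex_of_real (cmod b)) = - complex_of_real (cmod b)"
      by (simp add: complex_norm_square[symmetric] power2_eq_square)
    then show ?thesis
      using False by (intro that[of "- cnj b / complex_of_real (cmod b)"]) (auto simp: norm_divide)
  qed
  define x where "x = vec n (\<lambda>k. if k = i then 1 else if k = j then z else 0)"
  have x: "x \<in> carrier_vec n" by (simp add: x_def)
  have supp: "(\<Sum>k<n. f k) = f i + f j" if "\<And>k. k \<noteq> i \<Longrightarrow> k \<noteq> j \<Longrightarrow> f k = 0" for f :: "nat \<Rightarrow> complex"
  proof -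
    have "(\<Sum>k<n. f k) = sum f {i, j}"
      by (rule sum.mono_neutral_right) (use ij that in auto)
    then show ?thesis using ij by simp
  qed
  have xk: "x $ k = (if k = i then 1 else if k = j then z else 0)" if "k < n" for k
    using that by (simp add: x_def)
  have "x \<bullet>c x = (\<Sum>k<n. if k = i then 1 else if k = j then z * cnj z else 0)"
    using x xk by (auto simp: scalar_prod_def lessThan_atLeast0 intro!: sum.cong)
  also have "\<dots> = 2"
    by (subst supp) (use ij z in \<open>auto simp: complex_norm_square[symmetric]\<close>)
  finally have "complex_of_real ((euclidean_norm x)\<^sup>2) = complex_of_real 2"
    unfolding euclidean_norm_power2 by simp
  then have norm_x: "(euclidean_norm x)\<^sup>2 = 2" by (simp only: of_real_eq_iff)
  have Bx: "(B *\<^sub>v x) $ k = B $$ (k, i) + B $$ (k, j) * z" if "k < n" for k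
  proof -
    have "(B *\<^sub>v x) $ k = (\<Sum>l<n. if l = i then B $$ (k, i) else if l = j then B $$ (k, j) * z else 0)"
      unfolding index_mult_mat_vec_sum[OF B x that] by (rule sum.cong) (auto simp: xk)
    also have "\<dots> = B $$ (k, i) + B $$ (k, j) * z"
      by (subst supp) (use ij in auto)
    finally show ?thesis .
  qed
  have "(B *\<^sub>v x) \<bullet>c x = (\<Sum>k<n. if k = i then (B *\<^sub>v x) $ i else if k = j then (B *\<^sub>v x) $ j * cnj z else 0)"
    using x xk by (auto simp: scalar_prod_def lessThan_atLeast0 intro!: sum.cong)
  also have "\<dots> = (B *\<^sub>v x) $ i + (B *\<^sub>v x) $ j * cnj z"
    by (subst supp) (use ij in auto)
  also have "\<dots> = B $$ (i, i) + b * z + (B $$ (j, i) + B $$ (j, j) * z) * cnj z"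
    using ij by (simp add: Bx b_def)
  also have "B $$ (j, i) = 0" using ut B ij by (auto simp: upper_triangular_def)
  also have "(0 + B $$ (j, j) * z) * cnj z = B $$ (j, j)"
    using z by (simp add: mult.assoc complex_norm_square[symmetric])
  finally have "Re ((B *\<^sub>v x) \<bullet>c x) = Re (B $$ (i, i)) - cmod b + Re (B $$ (j, j))"
    by (simp add: z)
  \<comment> \<open>Since |x|^2 = 2, halving the coercivity inequality gives the claim. The bound is
    the arithmetic mean of the two diagonal entries of B + B^* - 1; the determinant of the block
    would give the smaller geometric mean, but the arithmetic one suffices.\<close>
  then show ?thesis using coercive[OF x] norm_x by (simp add: b_def)
qed

lemma L2_set_reverse: "L2_set (\<lambda>i. f (n - Suc i)) {..<n} = L2_set f {..<n}"
  unfolding L2_set_def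
  by (rule arg_cong[where f = sqrt])
    (rule sum.reindex_bij_witness[of _ "\<lambda>i. n - Suc i" "\<lambda>i. n - Suc i"]; auto)

text \<open>The index reversal turns upper triangular matrices into lower triangular ones.\<close>

lemma upper_triangular_operator_norm_le_X_matrix:
  fixes B :: "complex mat"
  assumes B: "B \<in> carrier_mat n n" and ut: "upper_triangular B" and K: "0 \<le> K" and \<beta>: "0 \<le> \<beta>"
    and diag: "\<And>i. i < n \<Longrightarrow> cmod (B $$ (i, i)) \<le> K"
    and off: "\<And>i j. i < j \<Longrightarrow> j < n \<Longrightarrow> cmod (B $$ (i, j)) \<le> K * \<beta>"
    and w: "w \<in> carrier_vec n"
  shows "euclidean_norm (B *\<^sub>v w) \<le> K * operator_norm (X_matrix n \<beta>) * euclidean_norm w"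
proof -
  \<comment> \<open>The moduli of \<open>w\<close> in reversed order, so that the coordinates of
    \<open>X_matrix n \<beta> *\<^sub>v s\<close> are nonnegative reals that majorize those of
    \<open>B *\<^sub>v w\<close> up to the factor \<open>K\<close>.\<close>
  define s where "s = vec n (\<lambda>j. complex_of_real (cmod (w $ (n - Suc j))))"
  have s: "s \<in> carrier_vec n" by (simp add: s_def)
  have X: "X_matrix n \<beta> \<in> carrier_mat n n" by (simp add: X_matrix_def)
  define Xs where "Xs = X_matrix n \<beta> *\<^sub>v s"
  have norm_s: "euclidean_norm s = euclidean_norm w"
    using w L2_set_reverse[of "\<lambda>j. cmod (w $ j)" n] unfolding euclidean_norm_def s_def
    by (simp cong: L2_set_cong_simp)
  have entry: "cmod ((B *\<^sub>v w) $ i) \<le> K * cmod (Xs $ (n - Suc i))" if i: "i < n" for i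
  proof -
    \<comment> \<open>Row \<open>n - Suc i\<close> of \<open>X_matrix n \<beta>\<close> read
      backwards: the zeros now precede the diagonal position \<open>i\<close>.\<close>
    define x where "x j = (if j < i then 0 else if j = i then 1 else \<beta>)" for j
    have "Xs $ (n - Suc i) = (\<Sum>k<n. X_matrix n \<beta> $$ (n - Suc i, k) * s $ k)"
      unfolding Xs_def by (rule index_mult_mat_vec_sum[OF X s]) (use i in auto)
    also have "\<dots> = (\<Sum>j<n. X_matrix n \<beta> $$ (n - Suc i, n - Suc j) * s $ (n - Suc j))"
      by (rule sum.reindex_bij_witness[of _ "\<lambda>i. n - Suc i" "\<lambda>i. n - Suc i"]) auto
    also have "\<dots> = (\<Sum>j<n. complex_of_real (x j * cmod (w $ j)))"
    proof (rule sum.cong)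
      fix j assume "j \<in> {..<n}"
      then have j: "j < n" by simp
      have "X_matrix n \<beta> $$ (n - Suc i, n - Suc j) = complex_of_real (x j)"
        using i j unfolding X_matrix_def x_def by auto
      then show "X_matrix n \<beta> $$ (n - Suc i, n - Suc j) * s $ (n - Suc j)
          = complex_of_real (x j * cmod (w $ j))"
        using j by (simp add: s_def)
    qed simp
    finally have Xs: "Xs $ (n - Suc i) = complex_of_real (\<Sum>j<n. x j * cmod (w $ j))" by simp
    have x_nonneg: "0 \<le> x j" for j using \<beta> by (simp add: x_def)
    have "cmod ((B *\<^sub>v w) $ i) \<le> (\<Sum>j<n. K * (x j * cmod (w $ j)))"
      unfolding index_mult_mat_vec_sum[OF B w i]
    proof (rule sum_norm_le)
      fix j assume "j \<in> {..<n}"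
      then have j: "j < n" by simp
      have "B $$ (i, j) = 0" if "j < i" using ut that i B by (auto simp: upper_triangular_def)
      then have "cmod (B $$ (i, j)) \<le> K * x j"
        using diag[OF i] off[of i j] j by (cases j i rule: linorder_cases) (auto simp: x_def)
      then show "cmod (B $$ (i, j) * w $ j) \<le> K * (x j * cmod (w $ j))"
        unfolding norm_mult mult.assoc[symmetric] by (rule mult_right_mono) simp
    qed
    also have "\<dots> = K * cmod (Xs $ (n - Suc i))"
      unfolding Xs norm_of_real using x_nonneg by (simp add: sum_distrib_left sum_nonneg)
    finally show ?thesis .
  qed
  have "euclidean_norm (B *\<^sub>v w) \<le> L2_set (\<lambda>i. K * cmod (Xs $ (n - Suc i))) {..<n}"
    unfolding euclidean_norm_def using B entry by (auto intro!: L2_set_mono)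
  also have "\<dots> = K * euclidean_norm Xs"
    unfolding L2_set_right_distrib[OF K, symmetric] L2_set_reverse[of "\<lambda>i. cmod (Xs $ i)"]
      euclidean_norm_def using X by (simp add: Xs_def)
  also have "\<dots> \<le> K * (operator_norm (X_matrix n \<beta>) * euclidean_norm w)"
    using euclidean_norm_mult_mat_vec_le[OF X s] K by (simp add: Xs_def norm_s mult_left_mono)
  finally show ?thesis by (simp add: mult.assoc)
qed

text \<open>Similar matrices share their characteristic polynomial, and that of a triangular matrix
  splits into linear factors with the diagonal entries as roots.\<close>

lemma upper_triangular_similar_eigenvalue:
  fixes A B U :: "complex mat"
  assumes A: "A \<in> carrier_mat n n" and B: "B \<in> carrier_mat n n" and ut: "upper_triangular B"
    and U: "U \<in> carrier_mat n n" "V \<in> carrier_mat n n" "V * U = 1\<^sub>m n" and AU: "A * U = U * B"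
    and i: "i < n"
  shows "eigenvalue A (B $$ (i, i))"
proof -
  have UV: "U * V = 1\<^sub>m n" using mat_mult_left_right_inverse[OF U(2,1,3)] .
  have "A = A * (U * V)" using A UV by simp
  also have "\<dots> = U * B * V"
    unfolding assoc_mult_mat[OF A U(1,2), symmetric] AU ..
  finally have "similar_mat_wit A B U V"
    by (intro similar_mat_witI[of _ _ n] UV U A B)
  then have "char_poly A = char_poly B"
    by (intro char_poly_similar) (auto simp: similar_mat_def)
  moreover have "B $$ (i, i) \<in> set (diag_mat B)"
    using i B by (auto simp: diag_mat_def)
  ultimately show ?thesis
    unfolding eigenvalue_root_char_poly[OF A]
    by (auto simp: char_poly_upper_triangular[OF B ut] intro: linear_poly_root)
qed

text \<open>The relation between \<open>K\<close> and \<open>\<beta>\<close> makes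
  \<open>K * \<beta>\<close> the largest off-diagonal modulus that coercivity allows when the
  diagonal entries are bounded by \<open>K\<close>. Unitary equivalence carries both hypotheses to
  the triangular form, and the norm estimate back.\<close>

theorem coercive_operator_norm_le:
  fixes A :: "complex mat"
  assumes A: "A \<in> carrier_mat n n" and K: "0 \<le> K" and K\<beta>: "K * \<beta> = 2 * K - 1" and \<beta>: "0 \<le> \<beta>"
    and coercive: "\<And>x. x \<in> carrier_vec n \<Longrightarrow> (euclidean_norm x)\<^sup>2 \<le> 2 * Re ((A *\<^sub>v x) \<bullet>c x)"
    and ev: "\<And>c. eigenvalue A c \<Longrightarrow> cmod c \<le> K"
  shows "operator_norm A \<le> K * operator_norm (X_matrix n \<beta>)"
proof -
  from unitary_schur_triangularization[OF A] obtain U B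
    where U: "U \<in> carrier_mat n n" and B: "B \<in> carrier_mat n n" and UU: "mat_adjoint U * U = 1\<^sub>m n"
      and ut: "upper_triangular B" and AU: "A * U = U * B" by blast
  note V = mat_adjoint_carrier[OF U]
  have UV: "U * mat_adjoint U = 1\<^sub>m n" using mat_mult_left_right_inverse[OF V U UU] .
  have diag: "cmod (B $$ (i, i)) \<le> K" if "i < n" for i
    using upper_triangular_similar_eigenvalue[OF A B ut U V UU AU that] ev by blast
  have AUx: "A *\<^sub>v (U *\<^sub>v x) = U *\<^sub>v (B *\<^sub>v x)" if "x \<in> carrier_vec n" for x
    using assoc_mult_mat_vec[OF A U that] assoc_mult_mat_vec[OF U B that] AU by simp
  have coercive_B: "(euclidean_norm x)\<^sup>2 \<le> 2 * Re ((B *\<^sub>v x) \<bullet>c x)" if x: "x \<in> carrier_vec n" for x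
  proof -
    have Bx: "B *\<^sub>v x \<in> carrier_vec n" and Ux: "U *\<^sub>v x \<in> carrier_vec n" using B U x by auto
    have "(A *\<^sub>v (U *\<^sub>v x)) \<bullet>c (U *\<^sub>v x) = (B *\<^sub>v x) \<bullet>c (mat_adjoint U *\<^sub>v (U *\<^sub>v x))"
      unfolding AUx[OF x] by (rule mult_mat_vec_adjoint[OF U Bx Ux])
    also have "mat_adjoint U *\<^sub>v (U *\<^sub>v x) = x"
      using assoc_mult_mat_vec[OF V U x] UU x by simp
    finally show ?thesis
      using coercive[OF Ux] unitary_euclidean_norm[OF U UU x] by simp
  qed
  have off: "cmod (B $$ (i, j)) \<le> K * \<beta>" if "i < j" "j < n" for i j
    using upper_triangular_coercive_entry_bound[OF B ut coercive_B that] diag[of i] diag[of j] that complex_Re_le_cmod[of "B $$ (i, i)"]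
      complex_Re_le_cmod[of "B $$ (j, j)"] K\<beta> by linarith
  have X: "X_matrix n \<beta> \<in> carrier_mat n n" by (simp add: X_matrix_def)
  show ?thesis
  proof (rule operator_norm_le[OF A])
    show "0 \<le> K * operator_norm (X_matrix n \<beta>)" using K operator_norm_nonneg[OF X] by simp
    fix v :: "complex vec" assume v: "v \<in> carrier_vec n"
    define w where "w = mat_adjoint U *\<^sub>v v"
    have w: "w \<in> carrier_vec n" using V v by (simp add: w_def)
    have vw: "v = U *\<^sub>v w"
      unfolding w_def using assoc_mult_mat_vec[OF U V v] UV v by simp
    have "euclidean_norm (A *\<^sub>v v) = euclidean_norm (B *\<^sub>v w)"
      unfolding vw AUx[OF w] by (rule unitary_euclidean_norm[OF U UU]) (use B w in auto)
    also have "\<dots> \<le> K * operator_norm (X_matrix n \<beta>) * euclidean_norm w"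
      using upper_triangular_operator_norm_le_X_matrix[OF B ut K \<beta> diag off w] .
    also have "euclidean_norm w = euclidean_norm v"
      unfolding vw unitary_euclidean_norm[OF U UU w] ..
    finally show "euclidean_norm (A *\<^sub>v v) \<le> K * operator_norm (X_matrix n \<beta>) * euclidean_norm v" .
  qed
qed

section \<open>Resolvents of contractions\<close>

text \<open>The bridge between contractivity and coercivity: |y - x| <= |y| holds exactly when |x|^2
  <= 2 Re <y, x>.\<close>

lemma euclidean_norm_diff_power2:
  assumes x: "x \<in> carrier_vec n" and y: "y \<in> carrier_vec n"
  shows "(euclidean_norm (y - x))\<^sup>2
    = (euclidean_norm y)\<^sup>2 - 2 * Re (y \<bullet>c x) + (euclidean_norm x)\<^sup>2"
proof -
  have sq: "(euclidean_norm v)\<^sup>2 = (\<Sum>i<n. (cmod (v $ i))\<^sup>2)" if "v \<in> carrier_vec n" for v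
    using that unfolding euclidean_norm_def L2_set_def by (simp add: sum_nonneg)
  have pointwise: "(cmod (a - b))\<^sup>2 = (cmod a)\<^sup>2 - 2 * Re (a * cnj b) + (cmod b)\<^sup>2" for a b
    unfolding cmod_power2 by (simp add: power2_eq_square algebra_simps)
  have "Re (y \<bullet>c x) = (\<Sum>i<n. Re (y $ i * cnj (x $ i)))"
    using x by (simp add: scalar_prod_def lessThan_atLeast0)
  then show ?thesis
    using x y
    by (simp add: sq pointwise sum.distrib sum_subtractf sum_distrib_left del: Re_complex_of_real times_complex.sel)
qed

lemma contractionsI:
  assumes "T \<in> carrier_mat n n"
    and "\<And>v. v \<in> carrier_vec n \<Longrightarrow> euclidean_norm (T *\<^sub>v v) \<le> euclidean_norm v"
  shows "T \<in> contractions n"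
  using assms operator_norm_le[of T n n 1] by (simp add: contractions_def)

lemma contractionsD:
  assumes "T \<in> contractions n"
  shows "T \<in> carrier_mat n n"
    and "v \<in> carrier_vec n \<Longrightarrow> euclidean_norm (T *\<^sub>v v) \<le> euclidean_norm v"
proof -
  show T: "T \<in> carrier_mat n n" using assms by (simp add: contractions_def)
  assume v: "v \<in> carrier_vec n"
  have "operator_norm T * euclidean_norm v \<le> euclidean_norm v"
    using assms by (simp add: contractions_def mult_left_le_one_le operator_norm_nonneg[OF T])
  then show "euclidean_norm (T *\<^sub>v v) \<le> euclidean_norm v"
    using euclidean_norm_mult_mat_vec_le[OF T v] by linarith
qed

lemma X_matrix_carrier: "X_matrix n \<beta> \<in> carrier_mat n n"
  by (simp add: X_matrix_def)

lemma T_star_carrier: "T_star n r \<in> carrier_mat n n"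
  by (simp add: T_star_def)

lemma eigenvalue_le_spectral_radius:
  assumes T: "T \<in> carrier_mat n n" and ev: "eigenvalue T k"
  shows "cmod k \<le> spectral_radius T"
  using spectral_radius_mem_max(2)[OF T eigenvalue_imp_nonzero_dim[OF T ev]] ev
  by (auto simp: spectrum_def)

text \<open>With \<open>D = \<zeta> (\<zeta> - T)\<^sup>-\<^sup>1\<close>, the vector \<open>D x - x = T (D x) / \<zeta>\<close> is no longer
  than \<open>D x\<close>, which makes \<open>D\<close> coercive.\<close>

theorem operator_norm_resolvent_le:
  assumes T: "T \<in> contractions n" and r: "0 < r" "r < 1" and \<zeta>: "1 \<le> cmod \<zeta>"
    and spec: "spectral_radius T \<le> r"
  shows "operator_norm (resolvent \<zeta> T) \<le> 1 / (1 - r) * operator_norm (X_matrix n (1 + r))"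
proof -
  note Tc = contractionsD(1)[OF T]
  have ev: "cmod k \<le> r" if "eigenvalue T k" for k
    using eigenvalue_le_spectral_radius[OF Tc that] spec by linarith
  have "\<not> eigenvalue T \<zeta>" using ev[of \<zeta>] \<zeta> r by auto
  note C = resolvent_inverts[OF Tc this]
  define D where "D = \<zeta> \<cdot>\<^sub>m resolvent \<zeta> T"
  have D: "D \<in> carrier_mat n n" using C by (simp add: D_def)
  have Dx: "D *\<^sub>v x = \<zeta> \<cdot>\<^sub>v (resolvent \<zeta> T *\<^sub>v x)" if "x \<in> carrier_vec n" for x
    unfolding D_def by (rule smult_mat_mult_mat_vec[OF C(1) that])
  \<comment> \<open>Rearranges (\<zeta> - T) z = x for z = (\<zeta> - T)^{-1} x, where \<zeta> z = D
    x.\<close>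
  have TC: "T *\<^sub>v (resolvent \<zeta> T *\<^sub>v x) = D *\<^sub>v x - x" if x: "x \<in> carrier_vec n" for x
  proof -
    define z where "z = resolvent \<zeta> T *\<^sub>v x"
    have z: "z \<in> carrier_vec n" using C(1) x by (simp add: z_def)
    have Z: "\<zeta> \<cdot>\<^sub>m 1\<^sub>m n \<in> carrier_mat n n" by simp
    have "(\<zeta> \<cdot>\<^sub>m 1\<^sub>m n - T) *\<^sub>v z = x"
      unfolding z_def using assoc_mult_mat_vec[OF minus_carrier_mat[OF Tc, of "\<zeta> \<cdot>\<^sub>m 1\<^sub>m n"] C(1) x] C(2) x
      by simp
    moreover have "(\<zeta> \<cdot>\<^sub>m 1\<^sub>m n - T) *\<^sub>v z = \<zeta> \<cdot>\<^sub>v z - T *\<^sub>v z"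
      unfolding minus_mult_distrib_mat_vec[OF Z Tc z] smult_mat_mult_mat_vec[OF one_carrier_mat z]
      using z by simp
    ultimately have eq: "\<zeta> \<cdot>\<^sub>v z - T *\<^sub>v z = x" by simp
    have "\<zeta> \<cdot>\<^sub>v z - (\<zeta> \<cdot>\<^sub>v z - T *\<^sub>v z) = T *\<^sub>v z"
      using z Tc by (intro eq_vecI) auto
    then show ?thesis unfolding eq by (simp add: Dx[OF x] z_def)
  qed
  have "operator_norm D \<le> 1 / (1 - r) * operator_norm (X_matrix n (1 + r))"
  proof (rule coercive_operator_norm_le[OF D])
    show "0 \<le> 1 / (1 - r)" "1 / (1 - r) * (1 + r) = 2 * (1 / (1 - r)) - 1" "0 \<le> 1 + r"
      using r by (auto simp: field_simps)
  next
    fix x :: "complex vec" assume x: "x \<in> carrier_vec n"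
    define z where "z = resolvent \<zeta> T *\<^sub>v x"
    have z: "z \<in> carrier_vec n" using C(1) x by (simp add: z_def)
    have "euclidean_norm (D *\<^sub>v x - x) \<le> euclidean_norm z"
      using contractionsD(2)[OF T z] TC[OF x] by (simp add: z_def)
    \<comment> \<open>Here |\<zeta>| \<ge> 1 is what makes \<open>D\<close> coercive.\<close>
    also have "\<dots> \<le> cmod \<zeta> * euclidean_norm z"
      using mult_right_mono[OF \<zeta>, of "euclidean_norm z"] by simp
    also have "\<dots> = euclidean_norm (D *\<^sub>v x)"
      unfolding Dx[OF x] z_def euclidean_norm_smult ..
    finally have "(euclidean_norm (D *\<^sub>v x - x))\<^sup>2 \<le> (euclidean_norm (D *\<^sub>v x))\<^sup>2"
      by (rule power_mono) simp
    then show "(euclidean_norm x)\<^sup>2 \<le> 2 * Re ((D *\<^sub>v x) \<bullet>c x)"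
      using euclidean_norm_diff_power2[OF x, of "D *\<^sub>v x"] D x by simp
  next
    fix d assume "eigenvalue D d"
    then obtain v where v: "v \<in> carrier_vec n" "v \<noteq> 0\<^sub>v n" and Dv: "D *\<^sub>v v = d \<cdot>\<^sub>v v"
      using D unfolding eigenvalue_def eigenvector_def by auto
    \<comment> \<open>The value 0 is separated only to permit division by \<open>d\<close>; the
      bound is trivial there.\<close>
    show "cmod d \<le> 1 / (1 - r)"
    proof (cases "d = 0")
      case True
      then show ?thesis using r by simp
    next
      case False
      define z where "z = resolvent \<zeta> T *\<^sub>v v"
      have z: "z \<in> carrier_vec n" using C(1) v by (simp add: z_def)
      have \<zeta>z: "\<zeta> \<cdot>\<^sub>v z = d \<cdot>\<^sub>v v" using Dx[OF v(1)] Dv by (simp add: z_def)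
      have v_eq: "v = (\<zeta> / d) \<cdot>\<^sub>v z"
      proof -
        have "v = (1 / d) \<cdot>\<^sub>v (d \<cdot>\<^sub>v v)" using False by (simp add: smult_smult_assoc)
        then show ?thesis unfolding \<zeta>z[symmetric] by (simp add: smult_smult_assoc)
      qed
      have "T *\<^sub>v z = d \<cdot>\<^sub>v v - v" using TC[OF v(1)] Dv by (simp add: z_def)
      also have "\<dots> = (d - 1) \<cdot>\<^sub>v v" using v by (intro eq_vecI) (auto simp: algebra_simps)
      also have "\<dots> = ((d - 1) * (\<zeta> / d)) \<cdot>\<^sub>v z"
        by (subst v_eq) (simp add: smult_smult_assoc)
      finally have "T *\<^sub>v z = ((d - 1) * (\<zeta> / d)) \<cdot>\<^sub>v z" .
      moreover have "z \<noteq> 0\<^sub>v n" using v v_eq by auto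
      \<comment> \<open>This eigenvalue k of \<open>T\<close> is the solution of d = \<zeta> /
        (\<zeta> - k).\<close>
      ultimately have "eigenvalue T ((d - 1) * (\<zeta> / d))"
        unfolding eigenvalue_def eigenvector_def using z Tc by auto
      \<comment> \<open>Combined with |\<zeta>| \<ge> 1 this gives |d| \<le> |d - 1| + 1 \<le> r |d|
        + 1.\<close>
      from ev[OF this] have "cmod (d - 1) * cmod \<zeta> \<le> r * cmod d"
        using False by (simp add: norm_mult norm_divide pos_divide_le_eq)
      moreover have "cmod (d - 1) \<le> cmod (d - 1) * cmod \<zeta>"
        using mult_left_mono[OF \<zeta>, of "cmod (d - 1)"] by simp
      moreover have "cmod d \<le> cmod (d - 1) + 1"
        using norm_triangle_ineq[of "d - 1" 1] by simp
      ultimately have "cmod d * (1 - r) \<le> 1" by (simp add: algebra_simps)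
      then show ?thesis using r by (simp add: field_simps)
    qed
  qed
  moreover have "operator_norm (resolvent \<zeta> T) \<le> operator_norm D"
    unfolding D_def operator_norm_smult[OF C(1)]
    using mult_right_mono[OF \<zeta> operator_norm_nonneg[OF C(1)]] by simp
  ultimately show ?thesis by linarith
qed

section \<open>The extremal Toeplitz matrix\<close>

text \<open>Both factors are lower triangular Toeplitz, so each entry is a convolution. Below the
  diagonal it is a finite geometric sum with ratio -r plus two boundary terms, and these
  cancel.\<close>

lemma one_minus_T_star_mult_X_matrix:
  "(1\<^sub>m n - T_star n r) * X_matrix n (1 + r) = complex_of_real (1 - r) \<cdot>\<^sub>m 1\<^sub>m n"
proof (rule eq_matI)
  fix i j
  assume "i < dim_row (complex_of_real (1 - r) \<cdot>\<^sub>m 1\<^sub>m n)" "j < dim_col (complex_of_real (1 - r) \<cdot>\<^sub>m 1\<^sub>m n)"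
  then have ij: "i < n" "j < n" by auto
  define a where "a k = (if i < k then 0 else if i = k then 1 - r else - ((- r) ^ (i - k - 1) * (1 - r\<^sup>2)))"
    for k
  define x where "x k = (if k < j then 0 else if k = j then 1 else 1 + r)" for k
  have "((1\<^sub>m n - T_star n r) * X_matrix n (1 + r)) $$ (i, j)
      = (\<Sum>k<n. (1\<^sub>m n - T_star n r) $$ (i, k) * X_matrix n (1 + r) $$ (k, j))"
    using ij by (simp add: scalar_prod_def lessThan_atLeast0 T_star_def X_matrix_def)
  also have "\<dots> = complex_of_real (\<Sum>k<n. a k * x k)"
    using ij unfolding of_real_sum
    by (intro sum.cong) (auto simp: T_star_def X_matrix_def a_def x_def)
  also have "(\<Sum>k<n. a k * x k) = (\<Sum>k = j..i. a k * x k)"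
    using ij by (intro sum.mono_neutral_right) (auto simp: a_def x_def)
  also have "\<dots> = (if i = j then 1 - r else 0)"
  proof (cases "j < i")
    case True
    define m where "m = i - j - 1"
    have im: "i = Suc (j + m)" using True by (simp add: m_def)
    \<comment> \<open>\<open>m\<close> counts the indices strictly between \<open>j\<close> and
      \<open>i\<close>, where \<open>x k\<close> is constantly \<open>1 + r\<close>.\<close>
    have geo: "(\<Sum>k = Suc j..<i. (- r) ^ (i - k - 1)) * (1 + r) = 1 - (- r) ^ m"
    proof -
      have "(\<Sum>k = Suc j..<i. (- r) ^ (i - k - 1)) = (\<Sum>l<m. (- r) ^ l)"
        by (rule sum.reindex_bij_witness[of _ "\<lambda>l. i - l - 1" "\<lambda>k. i - k - 1"]) (auto simp: im)
      then show ?thesis using one_diff_power_eq[of "- r" m] by (simp add: mult.commute)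
    qed
    have "(\<Sum>k = j..i. a k * x k) = a j * x j + (\<Sum>k = Suc j..<i. a k * x k) + a i * x i"
      using True by (simp add: sum.atLeast_Suc_atMost sum.last_plus im atLeastLessThanSuc_atLeastAtMost
          sum.atLeastLessThan_Suc)
    also have "(\<Sum>k = Suc j..<i. a k * x k)
        = (\<Sum>k = Suc j..<i. - (1 - r\<^sup>2) * ((- r) ^ (i - k - 1) * (1 + r)))"
      by (rule sum.cong) (auto simp: a_def x_def algebra_simps)
    also have "\<dots> = - (1 - r\<^sup>2) * (1 - (- r) ^ m)"
      unfolding sum_distrib_left[symmetric] sum_distrib_right[symmetric] geo ..
    \<comment> \<open>The multiple of (-r)^m in the middle sum cancels the term at \<open>j\<close>;
      the remaining -(1 - r^2) cancels (1 - r) (1 + r) at \<open>i\<close>.\<close>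
    finally show ?thesis
      using True by (simp add: a_def x_def m_def power2_eq_square algebra_simps)
  next
    case False
    then show ?thesis by (cases "i = j") (auto simp: a_def x_def)
  qed
  finally show "((1\<^sub>m n - T_star n r) * X_matrix n (1 + r)) $$ (i, j)
      = (complex_of_real (1 - r) \<cdot>\<^sub>m 1\<^sub>m n) $$ (i, j)"
    using ij by (simp split: if_splits)
qed (auto simp: T_star_def X_matrix_def)

text \<open>Factoring \<zeta> out of \<zeta> - \<zeta> \<open>T_star\<close> reduces the rotated
  matrix to \<zeta> = 1. The rotated version supplies a maximizer at every point of the unit
  circle.\<close>

lemma T_star_inverse:
  assumes r: "r < 1" and \<zeta>: "\<zeta> \<noteq> 0"
  shows "(\<zeta> \<cdot>\<^sub>m 1\<^sub>m n - \<zeta> \<cdot>\<^sub>m T_star n r)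
      * ((1 / \<zeta>) \<cdot>\<^sub>m (complex_of_real (1 / (1 - r)) \<cdot>\<^sub>m X_matrix n (1 + r))) = 1\<^sub>m n"
proof -
  define M where "M = 1\<^sub>m n - T_star n r"
  have M: "M \<in> carrier_mat n n" unfolding M_def by (rule minus_carrier_mat[OF T_star_carrier])
  have "\<zeta> \<cdot>\<^sub>m 1\<^sub>m n - \<zeta> \<cdot>\<^sub>m T_star n r = \<zeta> \<cdot>\<^sub>m M"
    unfolding M_def using T_star_carrier by (intro eq_matI) (auto simp: algebra_simps T_star_def)
  moreover have "(1 / \<zeta>) \<cdot>\<^sub>m (complex_of_real (1 / (1 - r)) \<cdot>\<^sub>m X_matrix n (1 + r))
      = (1 / \<zeta> * complex_of_real (1 / (1 - r))) \<cdot>\<^sub>m X_matrix n (1 + r)"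
    by (intro eq_matI) auto
  moreover have "(\<zeta> \<cdot>\<^sub>m M) * ((1 / \<zeta> * complex_of_real (1 / (1 - r))) \<cdot>\<^sub>m X_matrix n (1 + r))
      = (\<zeta> * (1 / \<zeta> * complex_of_real (1 / (1 - r)))) \<cdot>\<^sub>m (M * X_matrix n (1 + r))"
    using M X_matrix_carrier[of n "1 + r"]
    by (intro eq_matI) (auto simp: scalar_prod_def sum_distrib_left ac_simps)
  moreover have "\<dots> = 1\<^sub>m n"
    unfolding M_def one_minus_T_star_mult_X_matrix using r \<zeta> by (intro eq_matI) auto
  ultimately show ?thesis by simp
qed

text \<open>The all-ones part contributes (1 + r) |t|^2 with \<open>t\<close> the sum of the
  coordinates; it is nonnegative for r \<ge> -1 and is dropped.\<close>

lemma X_matrix_coercive: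
  assumes u: "u \<in> carrier_vec n" and r: "- 1 \<le> r"
  shows "(1 - r) * (euclidean_norm u)\<^sup>2 \<le> 2 * Re ((X_matrix n (1 + r) *\<^sub>v u) \<bullet>c u)"
proof -
  define x :: "nat \<Rightarrow> nat \<Rightarrow> complex"
    where "x i j = (if i < j then 0 else if i = j then 1 else 1 + complex_of_real r)" for i j
  define S where "S = (X_matrix n (1 + r) *\<^sub>v u) \<bullet>c u"
  define t where "t = (\<Sum>i<n. u $ i)"
  have S: "S = (\<Sum>i<n. \<Sum>j<n. x i j * (u $ j * cnj (u $ i)))"
    unfolding S_def using u
    by (auto simp: scalar_prod_def lessThan_atLeast0 sum_distrib_right X_matrix_def x_def mult.assoc
        intro!: sum.cong)
  have "cnj S = (\<Sum>i<n. \<Sum>j<n. x i j * (u $ i * cnj (u $ j)))"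
    unfolding S by (auto simp: x_def intro!: sum.cong)
  also have "\<dots> = (\<Sum>i<n. \<Sum>j<n. x j i * (u $ j * cnj (u $ i)))"
    by (rule sum.swap)
  finally have cnj_S: "cnj S = (\<Sum>i<n. \<Sum>j<n. x j i * (u $ j * cnj (u $ i)))" .
  have "S + cnj S = (\<Sum>i<n. \<Sum>j<n. (x i j + x j i) * (u $ j * cnj (u $ i)))"
    unfolding cnj_S by (subst S) (simp add: sum.distrib distrib_right)
  \<comment> \<open>On the diagonal the coefficient 2 splits as (1 + r) + (1 - r).\<close>
  also have "\<dots> = (\<Sum>i<n. \<Sum>j<n. complex_of_real (1 + r) * (u $ j * cnj (u $ i))
      + (if j = i then complex_of_real (1 - r) * (u $ i * cnj (u $ i)) else 0))"
    by (intro sum.cong) (auto simp: x_def algebra_simps)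
  also have "\<dots> = complex_of_real (1 + r) * (\<Sum>i<n. \<Sum>j<n. u $ j * cnj (u $ i))
      + complex_of_real (1 - r) * (\<Sum>i<n. u $ i * cnj (u $ i))"
    by (simp add: sum.distrib sum_distrib_left)
  also have "(\<Sum>i<n. \<Sum>j<n. u $ j * cnj (u $ i)) = t * cnj t"
    unfolding t_def cnj_sum sum_product by (rule sum.swap)
  also have "(\<Sum>i<n. u $ i * cnj (u $ i)) = complex_of_real ((euclidean_norm u)\<^sup>2)"
    unfolding euclidean_norm_power2 using u by (simp add: scalar_prod_def lessThan_atLeast0)
  also have "t * cnj t = complex_of_real ((cmod t)\<^sup>2)"
    by (rule complex_norm_square[symmetric])
  finally have "complex_of_real (2 * Re S)
      = complex_of_real ((1 + r) * (cmod t)\<^sup>2 + (1 - r) * (euclidean_norm u)\<^sup>2)"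
    unfolding complex_add_cnj by simp
  then have "2 * Re S = (1 + r) * (cmod t)\<^sup>2 + (1 - r) * (euclidean_norm u)\<^sup>2"
    by (simp only: of_real_eq_iff)
  then show ?thesis using r by (simp add: S_def)
qed

text \<open>The resolvent argument backwards: for u = (1 - T) v one has v = X u / (1 - r) and T v =
  v - u, so coercivity of X gives |v - u| \<le> |v|.\<close>

lemma T_star_contraction:
  assumes r: "0 < r" "r < 1"
  shows "T_star n r \<in> contractions n"
proof (rule contractionsI[OF T_star_carrier])
  fix v :: "complex vec" assume v: "v \<in> carrier_vec n"
  define M where "M = 1\<^sub>m n - T_star n r"
  have M: "M \<in> carrier_mat n n" unfolding M_def by (rule minus_carrier_mat[OF T_star_carrier])
  define u where "u = M *\<^sub>v v"
  have u: "u \<in> carrier_vec n" using M v by (simp add: u_def)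
  define C where "C = complex_of_real (1 / (1 - r)) \<cdot>\<^sub>m X_matrix n (1 + r)"
  have C: "C \<in> carrier_mat n n" using X_matrix_carrier by (simp add: C_def)
  have "(1 :: complex) \<cdot>\<^sub>m A = A" for A by (intro eq_matI) auto
  then have "M * C = 1\<^sub>m n" using T_star_inverse[OF r(2), of 1 n] by (simp add: M_def C_def)
  from mat_mult_left_right_inverse[OF M C this] have "C * M = 1\<^sub>m n" .
  then have Cu: "C *\<^sub>v u = v"
    unfolding u_def using assoc_mult_mat_vec[OF C M v] v by simp
  have "v \<bullet>c u = complex_of_real (1 / (1 - r)) * ((X_matrix n (1 + r) *\<^sub>v u) \<bullet>c u)"
    unfolding Cu[symmetric] C_def smult_mat_mult_mat_vec[OF X_matrix_carrier u]
    by (rule smult_scalar_prod_distrib[of _ n]) (use u mult_mat_vec_carrier[OF X_matrix_carrier u] in auto)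
  then have "(1 - r) * Re (v \<bullet>c u) = Re ((X_matrix n (1 + r) *\<^sub>v u) \<bullet>c u)"
    using r by simp
  then have "(1 - r) * (euclidean_norm u)\<^sup>2 \<le> (1 - r) * (2 * Re (v \<bullet>c u))"
    using X_matrix_coercive[OF u, of r] r unfolding mult.left_commute[of "1 - r" 2] by linarith
  then have le: "(euclidean_norm u)\<^sup>2 \<le> 2 * Re (v \<bullet>c u)"
    using r by (simp only: mult_le_cancel_left_pos diff_gt_0_iff_gt)
  have "u = v - T_star n r *\<^sub>v v"
    unfolding u_def M_def minus_mult_distrib_mat_vec[OF one_carrier_mat T_star_carrier v]
    using v by simp
  then have "T_star n r *\<^sub>v v = v - u"
    using v T_star_carrier[of n r] by (auto intro!: eq_vecI)
  then have "(euclidean_norm (T_star n r *\<^sub>v v))\<^sup>2 \<le> (euclidean_norm v)\<^sup>2"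
    using euclidean_norm_diff_power2[OF u v] le by simp
  then show "euclidean_norm (T_star n r *\<^sub>v v) \<le> euclidean_norm v"
    by (rule power2_le_imp_le) simp
qed

text \<open>The matrix is lower triangular with constant diagonal, so its characteristic determinant
  is a power of a single linear factor.\<close>

lemma eigenvalue_smult_T_star:
  assumes "eigenvalue (\<zeta> \<cdot>\<^sub>m T_star n r) k"
  shows "k = \<zeta> * complex_of_real r"
proof -
  define A where "A = \<zeta> \<cdot>\<^sub>m T_star n r"
  have A: "A \<in> carrier_mat n n" using T_star_carrier by (simp add: A_def)
  have cA: "char_matrix A k \<in> carrier_mat n n" using A by simp
  have "det (char_matrix A k) = prod_list (diag_mat (char_matrix A k))"
    by (rule det_lower_triangular[OF _ cA]) (use A in \<open>auto simp: char_matrix_def A_def T_star_def\<close>)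
  then have "0 \<in> set (diag_mat (char_matrix A k))"
    using assms eigenvalue_det[OF A, of k] by (simp add: A_def[symmetric] prod_list_zero_iff)
  then obtain i where "i < n" "char_matrix A k $$ (i, i) = 0"
    using cA by (auto simp: diag_mat_def)
  then show ?thesis using A by (auto simp: char_matrix_def A_def T_star_def)
qed

theorem theorem1:
  fixes n :: nat and r :: real
  assumes "n \<ge> 1" and "0 < r" and "r < 1"
  shows "T_star n r \<in> contractions n \<and>
    (\<forall>\<zeta> :: complex. \<forall>T \<in> contractions n.
       cmod \<zeta> \<ge> 1 \<and> spectral_radius T \<le> r \<longrightarrow>
       operator_norm (resolvent \<zeta> T) \<le> operator_norm (inverse_matrix (1\<^sub>m n - T_star n r))) \<and>
    operator_norm (inverse_matrix (1\<^sub>m n - T_star n r))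
      = 1 / (1 - r) * operator_norm (X_matrix n (1 + r)) \<and>
    (\<forall>\<zeta> :: complex. cmod \<zeta> = 1 \<longrightarrow>
       resolvent_sup n r \<zeta> = operator_norm (inverse_matrix (1\<^sub>m n - T_star n r)))"
proof -
  define N where "N = 1 / (1 - r) * operator_norm (X_matrix n (1 + r))"
  note Ts = T_star_carrier[of n r]
  \<comment> \<open>For |\<zeta>| = 1 the resolvent of the rotated matrix at \<zeta> is (1 -
    \<open>T_star\<close>)^{-1} / \<zeta>, whose norm does not depend on \<zeta>.\<close>
  have norm_resolvent: "operator_norm (resolvent \<zeta> (\<zeta> \<cdot>\<^sub>m T_star n r)) = N" if \<zeta>: "cmod \<zeta> = 1" for \<zeta>
  proof -
    have "cmod (complex_of_real (1 / (1 - r))) = 1 / (1 - r)"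
      unfolding norm_of_real using assms by simp
    then have coeff: "cmod (1 - complex_of_real r) = 1 - r"
      using assms by (simp add: norm_divide)
    define C where "C = (1 / \<zeta>) \<cdot>\<^sub>m (complex_of_real (1 / (1 - r)) \<cdot>\<^sub>m X_matrix n (1 + r))"
    have \<zeta>0: "\<zeta> \<noteq> 0" using \<zeta> by auto
    have dim: "dim_row (\<zeta> \<cdot>\<^sub>m T_star n r) = n" using Ts by simp
    have "resolvent \<zeta> (\<zeta> \<cdot>\<^sub>m T_star n r) = C"
      unfolding resolvent_def dim
      by (rule inverse_matrix_eqI[where n = n])
        (use T_star_inverse[OF assms(3) \<zeta>0, of n] X_matrix_carrier Ts in \<open>auto simp: C_def\<close>)
    then show ?thesis
      using \<zeta> assms X_matrix_carrier[of n "1 + r"] unfolding C_def N_def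
      by (simp add: operator_norm_smult[where m = n and n = n] norm_divide coeff)
  qed
  have one_smult: "(1 :: complex) \<cdot>\<^sub>m A = A" for A by (intro eq_matI) auto
  have inv: "operator_norm (inverse_matrix (1\<^sub>m n - T_star n r)) = N"
    using norm_resolvent[of 1] Ts by (simp add: one_smult resolvent_def)
  note bound = operator_norm_resolvent_le[where n = n, OF _ assms(2,3), folded N_def]
  have "resolvent_sup n r \<zeta> = N" if \<zeta>: "cmod \<zeta> = 1" for \<zeta>
    unfolding resolvent_sup_def
  \<comment> \<open>The supremum is attained at the rotated matrix, which settles nonemptiness and
    boundedness together.\<close>
  proof (rule cSup_eq_maximum)
    define T where "T = \<zeta> \<cdot>\<^sub>m T_star n r"
    have T: "T \<in> carrier_mat n n" using Ts by (simp add: T_def)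
    have "T \<in> contractions n"
    proof (rule contractionsI[OF T])
      fix v :: "complex vec" assume v: "v \<in> carrier_vec n"
      show "euclidean_norm (T *\<^sub>v v) \<le> euclidean_norm v"
        unfolding T_def smult_mat_mult_mat_vec[OF Ts v] euclidean_norm_smult \<zeta>
        using contractionsD(2)[OF T_star_contraction[OF assms(2,3)] v] by simp
    qed
    moreover have "spectral_radius T \<le> r"
    \<comment> \<open>The assumption \<open>n \<ge> 1\<close> makes the spectrum nonempty, so the
      spectral radius is the modulus of an actual eigenvalue.\<close>
    proof -
      from spectral_radius_mem_max(1)[OF T] assms(1) obtain k
        where "eigenvalue T k" "spectral_radius T = cmod k"
        by (auto simp: spectrum_def)
      then show ?thesis
        using eigenvalue_smult_T_star[of \<zeta> n r k] \<zeta> assms by (simp add: T_def norm_mult)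
    qed
    ultimately show "N \<in> {operator_norm (resolvent \<zeta> T) | T. T \<in> contractions n \<and> spectral_radius T \<le> r}"
      using norm_resolvent[OF \<zeta>] unfolding T_def by blast
  next
    fix x assume "x \<in> {operator_norm (resolvent \<zeta> T) | T. T \<in> contractions n \<and> spectral_radius T \<le> r}"
    then show "x \<le> N" using bound \<zeta> by auto
  qed
  then show ?thesis
    using T_star_contraction[OF assms(2,3)] bound by (auto simp: inv) (simp add: N_def)
qed

end
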